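(* Let $G$ be a topological group and $X$ a $G$-space. A) If $X$ satisfies property (a), then $X$ is a disjoint union of clopen sets, each clopen set from this union is the closure of the orbit of some point, and thus it contains a continuous one-to-one image of some quotient space of the group $G$. B) If $X$ satisfies property (b), then in addition to the conclusion of A), each clopen set of this disjoint union is the closure of the orbit of any of its points. However, orbits of different points from a common clopen set need not be homeomorphic: there exist a topological group and a $G$-space with property (b) for which some clopen set of the union contains two points whose orbits are not homeomorphic. C) If $X$ satisfies property (c), then each clopen set of this disjoint union is homeomorphic to the orbit of any of its points.
   Context: All spaces are Tychonoff. A $G$-space is a Tychonoff space $X$ with a continuous action $G\times X\to X$ of the topological group $G$. For $O\subset G$ and $x\in X$, $Ox=\{gx: g\in O\}$; the orbit of $x$ is $Gx$, with the subspace topology. Closure and interior are taken in $X$. A quotient space of $G$ is a coset space $G/H$ of $G$ by a subgroup $H$ with the quotient topology. Properties of a $G$-space $X$: (a) for any $x\in X$ and any open neighbourhood $O$ of the identity in $G$ there exists $y\in X$ such that $x\in\mathrm{int}\,\mathrm{cl}(Oy)$; (b) for any $x\in X$ and any open neighbourhood $O$ of the identity in $G$, $x\in\mathrm{int}\,\mathrm{cl}(Ox)$; (c) for any $x\in X$ and any open neighbourhood $O$ of the identity in $G$, $x\in\mathrm{int}(Ox)$. (Here (c) implies (b) and (b) implies (a), so the decomposition in A) is available in B) and C).) *)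

theory Defs
  imports "HOL-Analysis.Analysis" "HOL-Algebra.Group_Action" "HOL-Algebra.Left_Coset"
begin

definition Tychonoff_space :: "'a topology \<Rightarrow> bool" where
  "Tychonoff_space X \<longleftrightarrow> completely_regular_space X \<and> Hausdorff_space X"

locale topological_group = group G for G (structure) and T +
  assumes topspace_eq_carrier: "topspace T = carrier G"
    and continuous_mult: "continuous_map (prod_topology T T) T (\<lambda>(g, h). g \<otimes> h)"
    and continuous_inv: "continuous_map T T (\<lambda>g. inv g)"
    and Tychonoff_group: "Tychonoff_space T"

text \<open>Note that \<open>group_action\<close> makes every \<open>\<phi> g\<close> extensional, i.e. \<open>\<phi> g\<close> takes the value
  \<open>undefined\<close> outside \<open>topspace X\<close>. This is only a normalisation.\<close>

locale G_space = topological_group G T + group_action G "topspace X" \<phi>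
  for G (structure) and T and X :: "'x topology" and \<phi> +
  assumes Tychonoff_space: "Tychonoff_space X"
    and continuous_action: "continuous_map (prod_topology T X) X (\<lambda>(g, x). \<phi> g x)"

definition property_a ::
  "('g, 'm) monoid_scheme \<Rightarrow> 'g topology \<Rightarrow> 'x topology \<Rightarrow> ('g \<Rightarrow> 'x \<Rightarrow> 'x) \<Rightarrow> bool" where
  "property_a G T X \<phi> \<longleftrightarrow>
     (\<forall>x\<in>topspace X. \<forall>N. openin T N \<and> \<one>\<^bsub>G\<^esub> \<in> N \<longrightarrow>
        (\<exists>y\<in>topspace X. x \<in> X interior_of (X closure_of ((\<lambda>g. \<phi> g y) ` N))))"

definition property_b ::
  "('g, 'm) monoid_scheme \<Rightarrow> 'g topology \<Rightarrow> 'x topology \<Rightarrow> ('g \<Rightarrow> 'x \<Rightarrow> 'x) \<Rightarrow> bool" where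
  "property_b G T X \<phi> \<longleftrightarrow>
     (\<forall>x\<in>topspace X. \<forall>N. openin T N \<and> \<one>\<^bsub>G\<^esub> \<in> N \<longrightarrow>
        x \<in> X interior_of (X closure_of ((\<lambda>g. \<phi> g x) ` N)))"

definition property_c ::
  "('g, 'm) monoid_scheme \<Rightarrow> 'g topology \<Rightarrow> 'x topology \<Rightarrow> ('g \<Rightarrow> 'x \<Rightarrow> 'x) \<Rightarrow> bool" where
  "property_c G T X \<phi> \<longleftrightarrow>
     (\<forall>x\<in>topspace X. \<forall>N. openin T N \<and> \<one>\<^bsub>G\<^esub> \<in> N \<longrightarrow>
        x \<in> X interior_of ((\<lambda>g. \<phi> g x) ` N))"

definition coset_space ::
  "('g, 'm) monoid_scheme \<Rightarrow> 'g topology \<Rightarrow> 'g set \<Rightarrow> 'g set topology" where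
  "coset_space G T H =
     topology (\<lambda>\<U>. \<U> \<subseteq> lcosets\<^bsub>G\<^esub> H \<and> openin T {g \<in> carrier G. g <#\<^bsub>G\<^esub> H \<in> \<U>})"

lemma openin_coset_space:
  "openin (coset_space G T H) \<U> \<longleftrightarrow>
     \<U> \<subseteq> lcosets\<^bsub>G\<^esub> H \<and> openin T {g \<in> carrier G. g <#\<^bsub>G\<^esub> H \<in> \<U>}"
proof -
  let ?p = "\<lambda>\<U>. {g \<in> carrier G. g <#\<^bsub>G\<^esub> H \<in> \<U>}"
  have "?p (\<U> \<inter> \<V>) = ?p \<U> \<inter> ?p \<V>" for \<U> \<V>
    by auto
  moreover have "?p (\<Union>\<K>) = \<Union>(?p ` \<K>)" for \<K>
    by auto
  ultimately have "istopology (\<lambda>\<U>. \<U> \<subseteq> lcosets\<^bsub>G\<^esub> H \<and> openin T (?p \<U>))"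
    unfolding istopology_def by (auto intro!: openin_Int openin_Union)
  then show ?thesis
    by (simp add: coset_space_def)
qed

lemma topspace_coset_space:
  assumes "topspace T = carrier G"
  shows "topspace (coset_space G T H) = lcosets\<^bsub>G\<^esub> H"
proof -
  have "{g \<in> carrier G. g <#\<^bsub>G\<^esub> H \<in> lcosets\<^bsub>G\<^esub> H} = topspace T"
    using assms by (auto simp: LCOSETS_def)
  then have "openin (coset_space G T H) (lcosets\<^bsub>G\<^esub> H)"
    by (simp add: openin_coset_space)
  then show ?thesis
    by (metis openin_coset_space openin_subset openin_topspace subset_antisym)
qed

lemma quotient_map_coset_space:
  assumes "topspace T = carrier G"
  shows "quotient_map T (coset_space G T H) (\<lambda>g. g <#\<^bsub>G\<^esub> H)"
  unfolding quotient_map_def topspace_coset_space[OF assms] openin_coset_space assms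
  by (auto simp: LCOSETS_def)

definition continuous_injective_coset_image ::
  "('g, 'm) monoid_scheme \<Rightarrow> 'g topology \<Rightarrow> 'x topology \<Rightarrow> 'x set \<Rightarrow> bool" where
  "continuous_injective_coset_image G T X S \<longleftrightarrow>
     (\<exists>H f. subgroup H G \<and> continuous_map (coset_space G T H) X f \<and>
            inj_on f (lcosets\<^bsub>G\<^esub> H) \<and> f ` (lcosets\<^bsub>G\<^esub> H) = S)"

text \<open>Merely asking for some continuous injective image of some \<open>G/H\<close> inside \<open>U\<close> would be
  trivial (take \<open>H = G\<close>, whose image is a point). The image meant here is the dense orbit itself.\<close>

definition orbit_closure_decomposition ::
  "('g, 'm) monoid_scheme \<Rightarrow> 'g topology \<Rightarrow> 'x topology \<Rightarrow> ('g \<Rightarrow> 'x \<Rightarrow> 'x) \<Rightarrow> 'x set set \<Rightarrow> bool"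
  where
  "orbit_closure_decomposition G T X \<phi> \<D> \<longleftrightarrow>
     partition_on (topspace X) \<D> \<and>
     (\<forall>U\<in>\<D>. openin X U \<and> closedin X U \<and>
        (\<exists>x\<in>topspace X. U = X closure_of (orbit G \<phi> x) \<and>
           continuous_injective_coset_image G T X (orbit G \<phi> x)))"

end

theory Submission
  imports Defs
begin

text \<open>Orbit closures are invariant, so an orbit closure that contains a nonempty open set meeting the
  closure of a second orbit contains that whole second closure. Applied in both directions, two
  orbit closures with nonempty interior coincide as soon as one of them meets the interior of the
  other. Under (a) every point lies in the interior of some orbit closure; hence the orbit closures
  with nonempty interior are clopen and partition the space. Under (b) every orbit closure has
  nonempty interior, and under (c) every orbit is clopen.

  For the example in B), the isometries of the Cantor space (with its prefix metric) that preserve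
  the countable dense set of finitely supported sequences form a topological group under pointwise
  convergence. Translations by finitely supported sequences already give (b) and make that set a
  single orbit, whereas another orbit is uncountable.\<close>

section \<open>Orbit closures\<close>

context G_space
begin

lemma continuous_map_action:
  assumes "g \<in> carrier G"
  shows "continuous_map X X (\<phi> g)"
proof -
  have "continuous_map X (prod_topology T X) (\<lambda>x. (g, x))"
    using assms topspace_eq_carrier by (simp add: continuous_map_pairwise o_def)
  from continuous_map_compose[OF this continuous_action] show ?thesis
    by (simp add: o_def)
qed

lemma continuous_map_orbit:
  assumes "x \<in> topspace X"
  shows "continuous_map T X (\<lambda>g. \<phi> g x)"
proof -
  have "continuous_map T (prod_topology T X) (\<lambda>g. (g, x))"
    using assms by (simp add: continuous_map_pairwise o_def)
  from continuous_map_compose[OF this continuous_action] show ?thesis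
    by (simp add: o_def)
qed

lemma orbit_subset_topspace:
  assumes "x \<in> topspace X"
  shows "orbit G \<phi> x \<subseteq> topspace X"
  using assms element_image by (auto simp: orbit_def)

lemma orbit_eqI:
  assumes "x \<in> topspace X" "y \<in> orbit G \<phi> x"
  shows "orbit G \<phi> y = orbit G \<phi> x"
proof -
  have y: "y \<in> topspace X"
    using assms orbit_subset_topspace by blast
  then have "x \<in> orbit G \<phi> y"
    using assms orbit_sym by simp
  then have "z \<in> orbit G \<phi> y \<longleftrightarrow> z \<in> orbit G \<phi> x" if "z \<in> topspace X" for z
    using that assms y orbit_trans[of x y z] orbit_trans[of y x z] by blast
  then show ?thesis
    using orbit_subset_topspace[OF y] orbit_subset_topspace[OF assms(1)] by blast
qed

text \<open>By continuity \<open>\<phi> g\<close> maps the closure of a set into the closure of its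
  image, and it maps the orbit into itself.\<close>

lemma orbit_closure_closed_action:
  assumes "x \<in> topspace X" "g \<in> carrier G" "y \<in> X closure_of orbit G \<phi> x"
  shows "\<phi> g y \<in> X closure_of orbit G \<phi> x"
proof -
  have "\<phi> g ` orbit G \<phi> x \<subseteq> orbit G \<phi> x"
    using assms(1,2) by (auto simp: orbit_def composition_rule[symmetric])
  then show ?thesis
    using continuous_map_image_closure_subset[OF continuous_map_action[OF assms(2)], of "orbit G \<phi> x"]
      closure_of_mono[of "\<phi> g ` orbit G \<phi> x" "orbit G \<phi> x" X] assms(3) by blast
qed

lemma orbit_closure_subset:
  assumes "x \<in> topspace X" "y \<in> X closure_of orbit G \<phi> x"
  shows "X closure_of orbit G \<phi> y \<subseteq> X closure_of orbit G \<phi> x"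
proof (rule closure_of_minimal)
  show "orbit G \<phi> y \<subseteq> X closure_of orbit G \<phi> x"
    using orbit_closure_closed_action[OF assms(1) _ assms(2)] by (auto simp: orbit_def)
qed simp

text \<open>An open set that meets a closure meets the set itself, here in a point \<open>z\<close>
  of the orbit of \<open>y\<close>. This \<open>z\<close> generates the same orbit as
  \<open>y\<close> and lies in the closed invariant set spanned by \<open>x\<close>, so the whole
  second closure does too.\<close>

lemma orbit_closure_subset_if_open_meets:
  assumes "x \<in> topspace X" "y \<in> topspace X" "openin X V" "V \<subseteq> X closure_of orbit G \<phi> x"
    and "V \<inter> X closure_of orbit G \<phi> y \<noteq> {}"
  shows "X closure_of orbit G \<phi> y \<subseteq> X closure_of orbit G \<phi> x"
proof -
  have "V \<inter> orbit G \<phi> y \<noteq> {}"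
    using assms(3,5) openin_Int_closure_of_eq_empty by blast
  then obtain z where z: "z \<in> V" "z \<in> orbit G \<phi> y"
    by blast
  then have "orbit G \<phi> z = orbit G \<phi> y"
    using assms(2) by (intro orbit_eqI)
  moreover have "X closure_of orbit G \<phi> z \<subseteq> X closure_of orbit G \<phi> x"
    using z(1) assms(1,4) by (intro orbit_closure_subset) auto
  ultimately show ?thesis
    by simp
qed

text \<open>The first inclusion places the nonempty interior of the second closure inside the first
  closure. This is the meeting condition with the roles exchanged, hence the asymmetric
  assumptions.\<close>

lemma orbit_closures_eq_if_meet_interior:
  assumes "x \<in> topspace X" "y \<in> topspace X"
    and "X interior_of (X closure_of orbit G \<phi> x) \<inter> X closure_of orbit G \<phi> y \<noteq> {}"
    and "X interior_of (X closure_of orbit G \<phi> y) \<noteq> {}"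
  shows "X closure_of orbit G \<phi> x = X closure_of orbit G \<phi> y"
proof -
  have yx: "X closure_of orbit G \<phi> y \<subseteq> X closure_of orbit G \<phi> x"
    by (rule orbit_closure_subset_if_open_meets[OF assms(1,2) openin_interior_of interior_of_subset])
      fact
  have "X interior_of (X closure_of orbit G \<phi> y) \<inter> X closure_of orbit G \<phi> x \<noteq> {}"
    using yx assms(4) interior_of_subset[of X "X closure_of orbit G \<phi> y"] by blast
  then have "X closure_of orbit G \<phi> x \<subseteq> X closure_of orbit G \<phi> y"
    by (rule orbit_closure_subset_if_open_meets[OF assms(2,1) openin_interior_of interior_of_subset])
  with yx show ?thesis
    by blast
qed

section \<open>Orbits as injective images of coset spaces\<close>

text \<open>The left cosets of the stabilizer are the fibres of the orbit map. The forward direction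
  makes the map induced on cosets injective, the backward one makes it well defined.\<close>

lemma action_eq_iff_l_coset_stabilizer_eq:
  assumes "x \<in> topspace X" "g \<in> carrier G" "h \<in> carrier G"
  shows "\<phi> g x = \<phi> h x \<longleftrightarrow> g <# stabilizer G \<phi> x = h <# stabilizer G \<phi> x"
proof -
  let ?S = "stabilizer G \<phi> x"
  have S: "subgroup ?S G"
    using assms(1) by (rule stabilizer_subgroup)
  have coset: "k \<in> g <# ?S \<longleftrightarrow> k \<in> carrier G \<and> \<phi> k x = \<phi> g x" if "g \<in> carrier G" for g k
  proof
    assume "k \<in> g <# ?S"
    then show "k \<in> carrier G \<and> \<phi> k x = \<phi> g x"
      using that assms(1) by (auto simp: l_coset_def stabilizer_def composition_rule)
  next
    assume k: "k \<in> carrier G \<and> \<phi> k x = \<phi> g x"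
    then have "\<phi> (inv g \<otimes> k) x = x"
      using that assms(1) by (simp add: composition_rule orbit_sym_aux)
    then have "inv g \<otimes> k \<in> ?S"
      using that k by (simp add: stabilizer_def)
    moreover have "k = g \<otimes> (inv g \<otimes> k)"
      using that k by (simp add: m_assoc[symmetric])
    ultimately show "k \<in> g <# ?S"
      unfolding l_coset_def by blast
  qed
  show ?thesis
  proof
    assume "\<phi> g x = \<phi> h x"
    then show "g <# ?S = h <# ?S"
      using coset[OF assms(2)] coset[OF assms(3)] by (simp add: set_eq_iff)
  next
    assume "g <# ?S = h <# ?S"
    then show "\<phi> g x = \<phi> h x"
      using coset[OF assms(2), of g] coset[OF assms(3), of g] assms(2) by simp
  qed
qed

text \<open>The orbit map descends to the cosets of the stabilizer, and its continuity descends
  because the projection is a quotient map.\<close>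

lemma orbit_continuous_injective_coset_image:
  assumes "x \<in> topspace X"
  shows "continuous_injective_coset_image G T X (orbit G \<phi> x)"
proof -
  let ?S = "stabilizer G \<phi> x" and ?q = "\<lambda>g. g <# stabilizer G \<phi> x"
  \<comment> \<open>The value does not depend on the representative chosen; this is the fact
    \<open>f\<close>.\<close>
  let ?f = "\<lambda>K. \<phi> (SOME g. g \<in> carrier G \<and> ?q g = K) x"
  have f: "?f (?q g) = \<phi> g x" if "g \<in> carrier G" for g
  proof -
    have "(SOME h. h \<in> carrier G \<and> ?q h = ?q g) \<in> carrier G \<and>
        ?q (SOME h. h \<in> carrier G \<and> ?q h = ?q g) = ?q g"
      by (rule someI[of _ g]) (use that in simp)
    then show ?thesis
      using action_eq_iff_l_coset_stabilizer_eq[OF assms _ that] by blast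
  qed
  have "continuous_map T X (?f \<circ> ?q)"
    using continuous_map_orbit[OF assms] by (rule continuous_map_eq) (simp add: topspace_eq_carrier f)
  then have "continuous_map (coset_space G T ?S) X ?f"
    using continuous_compose_quotient_map quotient_map_coset_space[OF topspace_eq_carrier] by blast
  moreover have "inj_on ?f (lcosets ?S)"
    by (rule inj_onI) (auto simp: LCOSETS_def f action_eq_iff_l_coset_stabilizer_eq[OF assms])
  moreover have "?f ` (lcosets ?S) = orbit G \<phi> x"
    by (force simp: LCOSETS_def orbit_def f image_iff)
  ultimately show ?thesis
    using stabilizer_subgroup[OF assms] unfolding continuous_injective_coset_image_def by blast
qed

section \<open>The clopen partition under (a)\<close>

text \<open>Turns (a), (b) and (c), applied to the whole group as a neighbourhood of the identity,
  into statements about orbits.\<close>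

lemma image_carrier_eq_orbit: "(\<lambda>g. \<phi> g x) ` carrier G = orbit G \<phi> x"
  by (auto simp: orbit_def)

lemma openin_carrier: "openin T (carrier G)"
  using openin_topspace[of T] by (simp add: topspace_eq_carrier)

lemma property_a_imp_decomposition:
  assumes "property_a G T X \<phi>"
  shows "\<exists>\<D>. orbit_closure_decomposition G T X \<phi> \<D>"
proof -
  let ?cl = "\<lambda>y. X closure_of orbit G \<phi> y"
  \<comment> \<open>Property (a) puts each point into the interior of some orbit closure, not
    necessarily that of its own orbit. So the partition is indexed by the points whose orbit closure
    has nonempty interior.\<close>
  define Y where "Y = {y \<in> topspace X. X interior_of ?cl y \<noteq> {}}"
  have cover: "\<exists>y\<in>Y. x \<in> X interior_of ?cl y" if "x \<in> topspace X" for x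
  proof -
    have "\<exists>y\<in>topspace X. x \<in> X interior_of (X closure_of ((\<lambda>g. \<phi> g y) ` carrier G))"
      using assms that openin_carrier unfolding property_a_def by blast
    then show ?thesis
      by (auto simp: Y_def image_carrier_eq_orbit)
  qed
  have eq: "?cl x = ?cl y" if "x \<in> Y" "y \<in> Y" "z \<in> X interior_of ?cl x" "z \<in> ?cl y" for x y z
    using that by (intro orbit_closures_eq_if_meet_interior) (auto simp: Y_def)
  \<comment> \<open>A point \<open>z\<close> of \<open>?cl y\<close> is interior to some
    \<open>?cl x\<close> by \<open>cover\<close>. The two closures then coincide by
    \<open>eq\<close>, so \<open>z\<close> is interior to \<open>?cl y\<close>.\<close>
  have sub: "?cl y \<subseteq> X interior_of ?cl y" if "y \<in> Y" for y
  proof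
    fix z assume z: "z \<in> ?cl y"
    then have "z \<in> topspace X"
      using closure_of_subset_topspace by fastforce
    then obtain x where "x \<in> Y" "z \<in> X interior_of ?cl x"
      using cover by blast
    with eq[of x y z] z that show "z \<in> X interior_of ?cl y"
      by auto
  qed
  have opn: "openin X (?cl y)" if "y \<in> Y" for y
  proof -
    have "?cl y = X interior_of ?cl y"
      using sub[OF that] interior_of_subset by (rule subset_antisym)
    then show ?thesis
      using openin_interior_of by metis
  qed
  have "partition_on (topspace X) (?cl ` Y)"
  proof (rule partition_onI)
    show "\<Union>(?cl ` Y) = topspace X"
      proof
      show "\<Union>(?cl ` Y) \<subseteq> topspace X"
        using closure_of_subset_topspace[of X] by fast
      show "topspace X \<subseteq> \<Union>(?cl ` Y)"
      proof
        fix x assume "x \<in> topspace X"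
        then obtain y where "y \<in> Y" "x \<in> X interior_of ?cl y"
          using cover by blast
        then show "x \<in> \<Union>(?cl ` Y)"
          using interior_of_subset[of X "?cl y"] by blast
      qed
    qed
    show "{} \<notin> ?cl ` Y"
      by (auto simp: Y_def)
    show "disjnt p q" if pq: "p \<in> ?cl ` Y" "q \<in> ?cl ` Y" "p \<noteq> q" for p q
    proof -
      obtain x y where xy: "x \<in> Y" "p = ?cl x" "y \<in> Y" "q = ?cl y"
        using pq(1,2) by blast
      have "z \<notin> q" if "z \<in> p" for z
        using eq[of x y z] sub[of x] that xy pq(3) by auto
      then show ?thesis
        unfolding disjnt_def by blast
    qed
  qed
  then have "orbit_closure_decomposition G T X \<phi> (?cl ` Y)"
    unfolding orbit_closure_decomposition_def
    using opn orbit_continuous_injective_coset_image by (auto simp: Y_def)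
  then show ?thesis
    by blast
qed

section \<open>Consequences of (b) and (c)\<close>

lemma property_b_imp_property_a:
  assumes "property_b G T X \<phi>"
  shows "property_a G T X \<phi>"
  using assms unfolding property_a_def property_b_def by blast

lemma property_c_imp_property_b:
  assumes "property_c G T X \<phi>"
  shows "property_b G T X \<phi>"
  unfolding property_b_def
proof (intro ballI allI impI)
  fix x N assume xN: "x \<in> topspace X" "openin T N \<and> \<one> \<in> N"
  have "N \<subseteq> carrier G"
    using xN openin_subset topspace_eq_carrier by blast
  then have "(\<lambda>g. \<phi> g x) ` N \<subseteq> topspace X"
    using element_image xN(1) by auto
  then have "X interior_of ((\<lambda>g. \<phi> g x) ` N) \<subseteq> X interior_of (X closure_of ((\<lambda>g. \<phi> g x) ` N))"
    by (intro interior_of_mono closure_of_subset)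
  then show "x \<in> X interior_of (X closure_of ((\<lambda>g. \<phi> g x) ` N))"
    using assms xN unfolding property_c_def by blast
qed

text \<open>The set \<open>U\<close> is the orbit closure of some \<open>y\<close>. By (b) the point
  \<open>x\<close> is interior to its own orbit closure, which therefore meets \<open>U\<close> in
  its interior.\<close>

lemma property_b_imp_eq_orbit_closure:
  assumes "property_b G T X \<phi>" "orbit_closure_decomposition G T X \<phi> \<D>" "U \<in> \<D>" "x \<in> U"
  shows "U = X closure_of orbit G \<phi> x"
proof -
  have int: "z \<in> X interior_of (X closure_of orbit G \<phi> z)" if "z \<in> topspace X" for z
    using assms(1) that openin_carrier image_carrier_eq_orbit unfolding property_b_def
    by (metis one_closed)
  obtain y where y: "y \<in> topspace X" "U = X closure_of orbit G \<phi> y"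
    using assms(2,3) unfolding orbit_closure_decomposition_def by blast
  then have x: "x \<in> topspace X"
    using assms(4) closure_of_subset_topspace by fastforce
  then have "X closure_of orbit G \<phi> x = X closure_of orbit G \<phi> y"
    using int assms(4) y by (intro orbit_closures_eq_if_meet_interior) blast+
  with y show ?thesis
    by simp
qed

text \<open>By (c) every point is interior to its own orbit, so orbits are open; the complement of
  an orbit is a union of other orbits.\<close>

lemma property_c_imp_closedin_orbit:
  assumes "property_c G T X \<phi>" "x \<in> topspace X"
  shows "closedin X (orbit G \<phi> x)"
proof -
  have opn: "openin X (orbit G \<phi> z)" if z: "z \<in> topspace X" for z
  proof -
    have "y \<in> X interior_of orbit G \<phi> z" if "y \<in> orbit G \<phi> z" for y
    proof -
      have "y \<in> topspace X"
        using that z orbit_subset_topspace by blast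
      then have "y \<in> X interior_of orbit G \<phi> y"
        using assms(1) openin_carrier image_carrier_eq_orbit unfolding property_c_def
        by (metis one_closed)
      then show ?thesis
        using orbit_eqI[OF z that] by simp
    qed
    then have "X interior_of orbit G \<phi> z = orbit G \<phi> z"
      using interior_of_subset[of X "orbit G \<phi> z"] by blast
    then show ?thesis
      using openin_interior_of by metis
  qed
  have "orbit G \<phi> z \<subseteq> topspace X - orbit G \<phi> x" if z: "z \<in> topspace X - orbit G \<phi> x" for z
  proof
    fix w assume w: "w \<in> orbit G \<phi> z"
    then have "w \<notin> orbit G \<phi> x"
      using z orbit_eqI[of z w] orbit_eqI[OF assms(2), of w] orbit_refl[of z] by auto
    then show "w \<in> topspace X - orbit G \<phi> x"
      using w z orbit_subset_topspace by auto
  qed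
  then have "topspace X - orbit G \<phi> x = (\<Union>z\<in>topspace X - orbit G \<phi> x. orbit G \<phi> z)"
    using orbit_refl by blast
  moreover have "openin X (\<Union>z\<in>topspace X - orbit G \<phi> x. orbit G \<phi> z)"
    using opn by (intro openin_Union) auto
  ultimately have "openin X (topspace X - orbit G \<phi> x)"
    by simp
  then show ?thesis
    using orbit_subset_topspace[OF assms(2)] by (simp add: closedin_def)
qed

lemma property_c_imp_eq_orbit:
  assumes "property_c G T X \<phi>" "orbit_closure_decomposition G T X \<phi> \<D>" "U \<in> \<D>" "x \<in> U"
  shows "U = orbit G \<phi> x"
proof -
  have U: "U = X closure_of orbit G \<phi> x"
    using property_b_imp_eq_orbit_closure[OF property_c_imp_property_b] assms by blast
  then have "x \<in> topspace X"
    using assms(4) closure_of_subset_topspace by fastforce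
  then have "closedin X (orbit G \<phi> x)"
    using assms(1) property_c_imp_closedin_orbit by blast
  then have "X closure_of orbit G \<phi> x = orbit G \<phi> x"
    by (simp only: closure_of_eq)
  with U show ?thesis
    by (rule trans)
qed

end

section \<open>An action on the Cantor space with orbits of different cardinality\<close>

text \<open>Because the first \<open>k\<close> values of \<open>g x\<close> depend only on the first \<open>k\<close> values of \<open>x\<close>, for all \<open>g\<close>
  at once, evaluation, composition and inversion are jointly continuous for pointwise
  convergence.\<close>

definition cantor_isometries :: "((nat \<Rightarrow> bool) \<Rightarrow> (nat \<Rightarrow> bool)) set" where
  "cantor_isometries = {g. bij g \<and>
     (\<forall>k x y. (\<forall>i<k. g x i = g y i) \<longleftrightarrow> (\<forall>i<k. x i = y i)) \<and>
     (\<forall>x. finite {i. g x i} \<longleftrightarrow> finite {i. x i})}"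

abbreviation cantor_group :: "((nat \<Rightarrow> bool) \<Rightarrow> (nat \<Rightarrow> bool)) monoid" where
  "cantor_group \<equiv> (BijGroup UNIV)\<lparr>carrier := cantor_isometries\<rparr>"

text \<open>The function types carry the product topology, so this is pointwise convergence.\<close>

abbreviation cantor_group_topology :: "((nat \<Rightarrow> bool) \<Rightarrow> (nat \<Rightarrow> bool)) topology" where
  "cantor_group_topology \<equiv> top_of_set cantor_isometries"

section \<open>The group structure on the isometries\<close>

lemma Bij_UNIV: "Bij UNIV = {f. bij f}"
  by (auto simp: Bij_def)

lemma cantor_isometries_subset_Bij: "cantor_isometries \<subseteq> Bij UNIV"
  by (auto simp: Bij_UNIV cantor_isometries_def)

lemma cantor_isometry_prefix_iff:
  assumes "g \<in> cantor_isometries"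
  shows "(\<forall>i<k. g x i = g y i) \<longleftrightarrow> (\<forall>i<k. x i = y i)"
  using assms by (simp add: cantor_isometries_def)

lemma cantor_isometry_finite_iff:
  assumes "g \<in> cantor_isometries"
  shows "finite {i. g x i} \<longleftrightarrow> finite {i. x i}"
  using assms by (simp add: cantor_isometries_def)

text \<open>The prefix and support conditions are equivalences, so evaluating them at preimages
  yields them for the inverse.\<close>

lemma inv_in_cantor_isometries:
  assumes "g \<in> cantor_isometries"
  shows "inv_into UNIV g \<in> cantor_isometries"
proof -
  let ?h = "inv_into UNIV g"
  have g: "bij g"
    using assms by (simp add: cantor_isometries_def)
  then have gh: "g (?h x) = x" for x
    by (simp add: bij_is_surj surj_f_inv_f)
  have "(\<forall>i<k. ?h x i = ?h y i) \<longleftrightarrow> (\<forall>i<k. x i = y i)" for k x y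
    using cantor_isometry_prefix_iff[OF assms, of k "?h x" "?h y"] by (simp add: gh)
  moreover have "finite {i. ?h x i} \<longleftrightarrow> finite {i. x i}" for x
    using cantor_isometry_finite_iff[OF assms, of "?h x"] by (simp add: gh)
  ultimately show ?thesis
    using g by (simp add: cantor_isometries_def bij_imp_bij_inv)
qed

lemma comp_in_cantor_isometries:
  assumes "g \<in> cantor_isometries" "h \<in> cantor_isometries"
  shows "g \<circ> h \<in> cantor_isometries"
  using assms by (auto simp: cantor_isometries_def bij_comp)

text \<open>For an involution, applying a one-sided implication to the images gives its converse.
  Both translations and odd flips are of this kind.\<close>

lemma involution_in_cantor_isometries:
  assumes invol: "\<And>x. h (h x) = x"
    and fin: "\<And>x. finite {i. x i} \<Longrightarrow> finite {i. h x i}"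
    and prefix: "\<And>k x y. \<forall>i<k. x i = y i \<Longrightarrow> \<forall>i<k. h x i = h y i"
  shows "h \<in> cantor_isometries"
proof -
  have "bij h"
    using invol by (rule involuntory_imp_bij)
  moreover have "finite {i. h x i} \<longleftrightarrow> finite {i. x i}" for x
    using fin[of x] fin[of "h x"] by (auto simp: invol)
  moreover have "(\<forall>i<k. h x i = h y i) \<longleftrightarrow> (\<forall>i<k. x i = y i)" for k x y
  proof
    show "\<forall>i<k. x i = y i" if "\<forall>i<k. h x i = h y i"
      using prefix[OF that] by (simp add: invol)
  qed (rule prefix)
  ultimately show ?thesis
    by (simp add: cantor_isometries_def)
qed

lemma BijGroup_UNIV_mult:
  assumes "g \<in> cantor_isometries" "h \<in> cantor_isometries"
  shows "g \<otimes>\<^bsub>BijGroup UNIV\<^esub> h = g \<circ> h"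
  using assms cantor_isometries_subset_Bij
  by (auto simp: BijGroup_def compose_def fun_eq_iff subset_iff)

lemma subgroup_cantor_isometries: "subgroup cantor_isometries (BijGroup UNIV)"
proof
  show "cantor_isometries \<subseteq> carrier (BijGroup UNIV)"
    using cantor_isometries_subset_Bij by (simp add: BijGroup_def)
  show "g \<otimes>\<^bsub>BijGroup UNIV\<^esub> h \<in> cantor_isometries"
    if "g \<in> cantor_isometries" "h \<in> cantor_isometries" for g h
    using that by (simp add: BijGroup_UNIV_mult comp_in_cantor_isometries)
  show "\<one>\<^bsub>BijGroup UNIV\<^esub> \<in> cantor_isometries"
    by (simp add: BijGroup_def cantor_isometries_def bij_id[unfolded id_def])
  show "inv\<^bsub>BijGroup UNIV\<^esub> g \<in> cantor_isometries" if "g \<in> cantor_isometries" for g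
  proof -
    have "g \<in> Bij UNIV"
      using that cantor_isometries_subset_Bij by blast
    with inv_in_cantor_isometries[OF that] show ?thesis
      by (simp add: inv_BijGroup restrict_def)
  qed
qed

lemma group_cantor_group: "group cantor_group"
  using subgroup_cantor_isometries group_BijGroup by (rule subgroup.subgroup_is_group)

lemma inv_cantor_group:
  assumes "g \<in> cantor_isometries"
  shows "inv\<^bsub>cantor_group\<^esub> g = inv_into UNIV g"
proof -
  have "inv\<^bsub>cantor_group\<^esub> g = inv\<^bsub>BijGroup UNIV\<^esub> g"
    using assms subgroup_cantor_isometries by (simp add: group.m_inv_consistent group_BijGroup)
  also have "\<dots> = inv_into UNIV g"
    using assms cantor_isometries_subset_Bij by (auto simp: inv_BijGroup restrict_def subset_iff)
  finally show ?thesis .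
qed

lemma group_action_cantor: "group_action cantor_group UNIV (\<lambda>g. g)"
proof -
  have "(\<lambda>g. g) \<in> hom cantor_group (BijGroup UNIV)"
    using cantor_isometries_subset_Bij by (auto simp: hom_def BijGroup_def)
  then show ?thesis
    by (simp add: group_action_def group_hom_def group_hom_axioms_def group_cantor_group group_BijGroup)
qed

section \<open>Continuity of evaluation, composition and inversion\<close>

text \<open>Since \<open>bool\<close> is discrete, a continuous coordinate is locally constant, and
  finitely many such conditions hold simultaneously near \<open>p\<close>.\<close>

lemma eventually_eq_coordinates:
  fixes f :: "'a::topological_space \<Rightarrow> nat \<Rightarrow> bool"
  assumes "\<And>i. continuous_on S (\<lambda>p. f p i)" "p \<in> S"
  shows "\<forall>\<^sub>F q in at p within S. \<forall>i<k. f q i = f p i"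
proof -
  have "\<forall>\<^sub>F q in at p within S. f q i = f p i" for i
    using assms by (metis (mono_tags) continuous_on_def tendsto_discrete)
  then have "\<forall>\<^sub>F q in at p within S. \<forall>i\<in>{..<k}. f q i = f p i"
    by (intro eventually_ball_finite) auto
  then show ?thesis
    by (rule eventually_mono) auto
qed

lemma continuous_on_boolI:
  fixes f :: "'a::topological_space \<Rightarrow> bool"
  assumes "\<And>p. p \<in> S \<Longrightarrow> \<forall>\<^sub>F q in at p within S. f q = f p"
  shows "continuous_on S f"
  using assms by (auto simp: continuous_on_def tendsto_discrete)

lemma continuous_on_cantor_evaluation:
  "continuous_on (cantor_isometries \<times> UNIV) (\<lambda>(g, x). g x)"
proof (rule continuous_on_coordinatewise_then_product)
  let ?S = "cantor_isometries \<times> (UNIV :: (nat \<Rightarrow> bool) set)"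
  fix n
  have 1: "continuous_on ?S (\<lambda>p. fst p y i)" for y i
    by (rule continuous_on_product_then_coordinatewise[OF
          continuous_on_product_then_coordinatewise[OF continuous_on_fst[OF continuous_on_id]]])
  have 2: "continuous_on ?S (\<lambda>p. snd p i)" for i
    by (rule continuous_on_product_then_coordinatewise[OF continuous_on_snd[OF continuous_on_id]])
  show "continuous_on ?S (\<lambda>p. (case p of (g, x) \<Rightarrow> g x) n)"
  proof (rule continuous_on_boolI)
    fix p assume p: "p \<in> ?S"
    obtain g x where gx: "p = (g, x)"
      by (cases p)
    have "\<forall>\<^sub>F q in at p within ?S. \<forall>i<Suc n. fst q x i = fst p x i"
      using 1 p by (rule eventually_eq_coordinates)
    moreover have "\<forall>\<^sub>F q in at p within ?S. \<forall>i<Suc n. snd q i = snd p i"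
      using 2 p by (rule eventually_eq_coordinates)
    moreover have "\<forall>\<^sub>F q in at p within ?S. q \<in> ?S"
      by (simp add: eventually_at_filter)
    ultimately show "\<forall>\<^sub>F q in at p within ?S.
        (case q of (g, x) \<Rightarrow> g x) n = (case p of (g, x) \<Rightarrow> g x) n"
    proof eventually_elim
      case (elim q)
      \<comment> \<open>The nearby map sends the nearby point and \<open>x\<close> to sequences with
        a common prefix, and at \<open>x\<close> it agrees with \<open>g\<close>. The bound
        \<open>Suc n\<close> includes coordinate \<open>n\<close>.\<close>
      have "fst q \<in> cantor_isometries"
        using elim(3) by auto
      then have "\<forall>i<Suc n. fst q (snd q) i = fst q (snd p) i"
        using elim(2) by (simp only: cantor_isometry_prefix_iff)
      with elim(1) show ?case
        by (simp add: gx case_prod_beta)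
    qed
  qed
qed

text \<open>Tychonoff spaces are closed under products. One application covers the Cantor space, two
  cover its self-maps.\<close>

lemma Tychonoff_space_euclidean_fun:
  assumes "Tychonoff_space (euclidean :: 'b::topological_space topology)"
  shows "Tychonoff_space (euclidean :: ('a \<Rightarrow> 'b) topology)"
  using assms unfolding Tychonoff_space_def euclidean_product_topology[symmetric]
  by (simp add: completely_regular_space_product_topology Hausdorff_space_product_topology)

lemma Tychonoff_space_bool: "Tychonoff_space (euclidean :: bool topology)"
proof -
  have "discrete_topology (UNIV :: bool set) = euclidean"
    by (simp add: discrete_topology_unique open_discrete)
  then show ?thesis
    by (metis Tychonoff_space_def completely_regular_space_discrete_topology Hausdorff_space_discrete_topology)
qed

lemma topological_group_cantor: "topological_group cantor_group cantor_group_topology"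
proof (intro topological_group.intro topological_group_axioms.intro group_cantor_group)
  let ?C = cantor_isometries
  show "topspace (top_of_set ?C) = carrier cantor_group"
    by simp
  show "Tychonoff_space (top_of_set ?C)"
    using Tychonoff_space_euclidean_fun[OF Tychonoff_space_euclidean_fun[OF Tychonoff_space_bool]]
    unfolding Tychonoff_space_def by (blast intro: completely_regular_space_subtopology Hausdorff_space_subtopology)
  have "continuous_on (?C \<times> ?C) (\<lambda>p x. fst p (snd p x))"
  proof (rule continuous_on_coordinatewise_then_product)
    fix x
    have snd: "continuous_on (?C \<times> ?C) (\<lambda>p. snd p x)"
      by (rule continuous_on_product_then_coordinatewise[OF continuous_on_snd[OF continuous_on_id]])
    \<comment> \<open>At a fixed \<open>x\<close>, composition is evaluation at the pair of the
      outer map and the image of \<open>x\<close> under the inner one.\<close>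
    have "continuous_on (?C \<times> ?C) (\<lambda>p. (fst p, snd p x))"
      using snd by (intro continuous_on_Pair continuous_on_fst continuous_on_id)
    then have "continuous_on (?C \<times> ?C) (\<lambda>p. case (fst p, snd p x) of (g, x) \<Rightarrow> g x)"
      by (rule continuous_on_compose2[OF continuous_on_cantor_evaluation]) auto
    then show "continuous_on (?C \<times> ?C) (\<lambda>p. fst p (snd p x))"
      by simp
  qed
  then have "continuous_on (?C \<times> ?C) (\<lambda>(g, h). g \<otimes>\<^bsub>cantor_group\<^esub> h)"
    by (rule continuous_on_eq) (auto simp: BijGroup_UNIV_mult)
  moreover have "(\<lambda>(g, h). g \<otimes>\<^bsub>cantor_group\<^esub> h) \<in> ?C \<times> ?C \<rightarrow> ?C"
    by (auto simp: BijGroup_UNIV_mult comp_in_cantor_isometries)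
  ultimately show "continuous_map (prod_topology (top_of_set ?C) (top_of_set ?C)) (top_of_set ?C)
      (\<lambda>(g, h). g \<otimes>\<^bsub>cantor_group\<^esub> h)"
    by (simp add: continuous_map_in_subtopology)
  have "continuous_on ?C (\<lambda>g. inv_into UNIV g)"
  proof (intro continuous_on_coordinatewise_then_product continuous_on_boolI)
    fix x n g assume g: "g \<in> ?C"
    \<comment> \<open>If \<open>h\<close> is close to \<open>g\<close> at the fixed point
      \<open>?y\<close>, then \<open>h ?y\<close> shares a prefix with \<open>x\<close>. Cancelling
      \<open>h\<close> shows that \<open>?y\<close> and the preimage of \<open>x\<close> under
      \<open>h\<close> share that prefix.\<close>
    let ?y = "inv_into UNIV g x"
    have "continuous_on ?C (\<lambda>h. h ?y i)" for i
      by (rule continuous_on_product_then_coordinatewise[OF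
            continuous_on_product_then_coordinatewise[OF continuous_on_id]])
    then have "\<forall>\<^sub>F h in at g within ?C. \<forall>i<Suc n. h ?y i = g ?y i"
      using g by (rule eventually_eq_coordinates)
    moreover have "\<forall>\<^sub>F h in at g within ?C. h \<in> ?C"
      by (simp add: eventually_at_filter)
    ultimately show "\<forall>\<^sub>F h in at g within ?C. inv_into UNIV h x n = ?y n"
    proof eventually_elim
      case (elim h)
      have "g ?y = x" "h (inv_into UNIV h x) = x"
        using g elim(2) by (simp_all add: cantor_isometries_def bij_is_surj surj_f_inv_f)
      then have "\<forall>i<Suc n. h ?y i = h (inv_into UNIV h x) i"
        using elim(1) by simp
      then have "\<forall>i<Suc n. ?y i = inv_into UNIV h x i"
        by (simp only: cantor_isometry_prefix_iff[OF elim(2)])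
      then show ?case
        by simp
    qed
  qed
  then have "continuous_on ?C (\<lambda>g. inv\<^bsub>cantor_group\<^esub> g)"
    by (rule continuous_on_eq) (simp add: inv_cantor_group)
  then show "continuous_map (top_of_set ?C) (top_of_set ?C) (\<lambda>g. inv\<^bsub>cantor_group\<^esub> g)"
    by (auto simp: continuous_map_in_subtopology inv_cantor_group inv_in_cantor_isometries)
qed

lemma G_space_cantor: "G_space cantor_group cantor_group_topology euclidean (\<lambda>g. g)"
proof (intro G_space.intro G_space_axioms.intro topological_group_cantor)
  show "group_action cantor_group (topspace euclidean) (\<lambda>g. g)"
    using group_action_cantor by simp
  show "Tychonoff_space (euclidean :: (nat \<Rightarrow> bool) topology)"
    by (intro Tychonoff_space_euclidean_fun Tychonoff_space_bool)
  show "continuous_map (prod_topology cantor_group_topology euclidean) euclidean (\<lambda>(g, x). g x)"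
    using continuous_on_cantor_evaluation
    by (simp add: prod_topology_subtopology)
qed

section \<open>Translations and property (b)\<close>

text \<open>Inequality of truth values is addition modulo 2, so this adds \<open>e\<close> to
  \<open>x\<close> coordinatewise.\<close>

definition cantor_translation :: "(nat \<Rightarrow> bool) \<Rightarrow> (nat \<Rightarrow> bool) \<Rightarrow> nat \<Rightarrow> bool" where
  "cantor_translation e x i \<longleftrightarrow> x i \<noteq> e i"

lemma cantor_translation_in_isometries:
  assumes "finite {i. e i}"
  shows "cantor_translation e \<in> cantor_isometries"
proof (rule involution_in_cantor_isometries)
  show "cantor_translation e (cantor_translation e x) = x" for x
    by (auto simp: cantor_translation_def)
  show "finite {i. cantor_translation e x i}" if "finite {i. x i}" for x
    by (rule finite_subset[of _ "{i. x i} \<union> {i. e i}"])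
      (use that assms in \<open>auto simp: cantor_translation_def\<close>)
  show "\<forall>i<k. cantor_translation e x i = cantor_translation e y i" if "\<forall>i<k. x i = y i" for k x y
    using that by (auto simp: cantor_translation_def)
qed

text \<open>Continuity in the parameter \<open>e\<close>: the first form pulls neighbourhoods of the
  identity map back to the Cantor space, the second moves open sets of parameters along
  \<open>x\<close>.\<close>

lemma continuous_on_cantor_translation:
  "continuous_on UNIV cantor_translation" "continuous_on UNIV (\<lambda>e. cantor_translation e x)"
proof -
  have *: "continuous_on UNIV (\<lambda>e. cantor_translation e x n)" for x n
  proof (rule continuous_on_boolI)
    fix e :: "nat \<Rightarrow> bool"
    have "\<forall>\<^sub>F e' in at e. \<forall>i<Suc n. e' i = e i"
      by (rule eventually_eq_coordinates) (auto intro: continuous_on_product_coordinates)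
    then show "\<forall>\<^sub>F e' in at e. cantor_translation e' x n = cantor_translation e x n"
      by eventually_elim (simp add: cantor_translation_def)
  qed
  show "continuous_on UNIV cantor_translation" "continuous_on UNIV (\<lambda>e. cantor_translation e x)"
    by (intro continuous_on_coordinatewise_then_product *)+
qed

text \<open>The truncations of \<open>p\<close> have finite support and converge to
  \<open>p\<close>.\<close>

lemma open_meets_finite_support:
  fixes Q :: "(nat \<Rightarrow> bool) set"
  assumes "open Q" "p \<in> Q"
  shows "\<exists>e\<in>Q. finite {i. e i}"
proof -
  have "(\<lambda>k i. p i \<and> i < k) \<longlonglongrightarrow> p"
  proof -
    have "limitin (product_topology (\<lambda>_. euclidean) UNIV) (\<lambda>k i. p i \<and> i < k) p sequentially"
      unfolding limitin_componentwise
    proof (intro conjI ballI)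
      fix i
      have "\<forall>\<^sub>F k in sequentially. (p i \<and> i < k) = p i"
        using eventually_gt_at_top[of i] by eventually_elim simp
      then show "limitin euclidean (\<lambda>k. p i \<and> i < k) (p i) sequentially"
        by (simp add: tendsto_discrete)
    qed auto
    then show ?thesis
      by (simp add: euclidean_product_topology)
  qed
  then have "\<forall>\<^sub>F k in sequentially. (\<lambda>i. p i \<and> i < k) \<in> Q"
    using assms by (rule topological_tendstoD)
  then obtain k where "(\<lambda>i. p i \<and> i < k) \<in> Q"
    by (meson eventually_happens trivial_limit_sequentially)
  then show ?thesis
    by (rule bexI[rotated]) auto
qed

text \<open>Translating \<open>x\<close> by all small sequences fills an open set around
  \<open>x\<close>. Those of finite support give elements of \<open>N\<close> and already reach a
  dense part of it.\<close>

lemma property_b_cantor: "property_b cantor_group cantor_group_topology euclidean (\<lambda>g. g)"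
  unfolding property_b_def
proof (intro ballI allI impI)
  fix x :: "nat \<Rightarrow> bool" and N
  assume "openin cantor_group_topology N \<and> \<one>\<^bsub>cantor_group\<^esub> \<in> N"
  then obtain W where W: "open W" "N = cantor_isometries \<inter> W" and "(\<lambda>x. x) \<in> W"
    by (auto simp: openin_open BijGroup_def restrict_def)
  \<comment> \<open>Built from \<open>W\<close> rather than \<open>N\<close>: admitting parameters
    of infinite support, whose translations lie outside the group, makes \<open>V\<close>
    open.\<close>
  define V where "V = cantor_translation -` W"
  have V: "open V"
    unfolding V_def using continuous_on_cantor_translation(1) W(1) by (rule open_vimage[rotated])
  have "cantor_translation (\<lambda>_. False) = (\<lambda>x. x)"
    by (auto simp: cantor_translation_def fun_eq_iff)
  then have V0: "(\<lambda>_. False) \<in> V"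
    using \<open>(\<lambda>x. x) \<in> W\<close> by (simp add: V_def)
  \<comment> \<open>As a map of the parameter this is an involution, so the image of
    \<open>V\<close> is also its preimage and hence open.\<close>
  let ?t = "\<lambda>e. cantor_translation e x"
  have invol: "?t (?t e) = e" for e
    by (auto simp: cantor_translation_def)
  have "?t ` V = ?t -` V"
    by (force simp: invol image_iff)
  then have opn: "open (?t ` V)"
    using continuous_on_cantor_translation(2) V by (metis open_vimage)
  have "?t ` V \<subseteq> closure ((\<lambda>g. g x) ` N)"
  proof
    fix p assume "p \<in> ?t ` V"
    then obtain e where e: "e \<in> V" "p = ?t e"
      by blast
    show "p \<in> closure ((\<lambda>g. g x) ` N)"
      unfolding closure_iff_nhds_not_empty
    proof (intro allI impI)
      fix A Q assume "Q \<subseteq> A" "open Q" "p \<in> Q"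
      \<comment> \<open>This set contains \<open>e\<close>, so density supplies a finitely supported
        \<open>d\<close> in it, whose translation lies in the group.\<close>
      have "open (V \<inter> ?t -` Q)"
        using V continuous_on_cantor_translation(2) \<open>open Q\<close> by (intro open_Int open_vimage)
      then obtain d where d: "d \<in> V" "?t d \<in> Q" "finite {i. d i}"
        using open_meets_finite_support[of "V \<inter> ?t -` Q" e] e \<open>p \<in> Q\<close> by auto
      then have "cantor_translation d \<in> N"
        using W(2) by (simp add: V_def cantor_translation_in_isometries)
      then show "(\<lambda>g. g x) ` N \<inter> A \<noteq> {}"
        using d \<open>Q \<subseteq> A\<close> by (auto simp: disjoint_iff)
    qed
  qed
  then have "?t ` V \<subseteq> interior (closure ((\<lambda>g. g x) ` N))"
    using opn by (rule interior_maximal)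
  moreover have "x \<in> ?t ` V"
    using V0 by (rule rev_image_eqI) (auto simp: cantor_translation_def)
  ultimately show "x \<in> euclidean interior_of (euclidean closure_of ((\<lambda>g. g x) ` N))"
    by auto
qed

text \<open>Flipping odd bits only where the preceding even bit is set is trivial far out on a finitely
  supported sequence, but moves the indicator of the even numbers to continuum many points.\<close>

definition odd_flip :: "(nat \<Rightarrow> bool) \<Rightarrow> (nat \<Rightarrow> bool) \<Rightarrow> nat \<Rightarrow> bool" where
  "odd_flip a x i \<longleftrightarrow> x i \<noteq> (odd i \<and> x (i - 1) \<and> a (i div 2))"

text \<open>Only odd bits change, and whether they do depends on even bits, which stay fixed; hence
  flipping twice is the identity.\<close>

lemma odd_flip_in_isometries: "odd_flip a \<in> cantor_isometries"
proof (rule involution_in_cantor_isometries)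
  show "odd_flip a (odd_flip a x) = x" for x
    by (auto simp: odd_flip_def fun_eq_iff)
  show "finite {i. odd_flip a x i}" if "finite {i. x i}" for x
  proof (rule finite_subset)
    \<comment> \<open>A newly set bit sits directly after a bit set in \<open>x\<close>.\<close>
    show "{i. odd_flip a x i} \<subseteq> {i. x i} \<union> Suc ` {i. x i}"
      by (force simp: odd_flip_def image_iff elim: oddE)
  qed (use that in simp)
  show "\<forall>i<k. odd_flip a x i = odd_flip a y i" if "\<forall>i<k. x i = y i" for k x y
    using that by (auto simp: odd_flip_def)
qed

section \<open>Cardinalities of the two orbits\<close>

lemma countable_finite_support: "countable {x :: nat \<Rightarrow> bool. finite {i. x i}}"
proof (rule countable_subset)
  show "{x :: nat \<Rightarrow> bool. finite {i. x i}} \<subseteq> (\<lambda>A i. i \<in> A) ` {A. finite A}"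
    by (auto intro!: image_eqI[where x = "{i. x i}" for x])
  show "countable ((\<lambda>A i. i \<in> A) ` {A :: nat set. finite A})"
    by (intro countable_image countable_Collect_finite)
qed

lemma uncountable_cantor: "uncountable (UNIV :: (nat \<Rightarrow> bool) set)"
proof
  assume "countable (UNIV :: (nat \<Rightarrow> bool) set)"
  then obtain f :: "nat \<Rightarrow> nat \<Rightarrow> bool" where "range f = UNIV"
    using uncountable_def by blast
  then obtain n where "f n = (\<lambda>i. \<not> f i i)"
    by (metis surjD)
  from fun_cong[OF this, of n] show False
    by simp
qed

text \<open>Translation by \<open>x\<close> carries zero to \<open>x\<close>; conversely, the group
  preserves finiteness of supports.\<close>

lemma cantor_orbit_zero: "orbit cantor_group (\<lambda>g. g) (\<lambda>_. False) = {x. finite {i. x i}}"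
proof -
  have "x = cantor_translation x (\<lambda>_. False)" for x
    by (auto simp: cantor_translation_def)
  then have "\<exists>g. x = g (\<lambda>_. False) \<and> g \<in> cantor_isometries" if "finite {i. x i}" for x
    using cantor_translation_in_isometries[OF that] by metis
  then show ?thesis
    by (auto simp: orbit_def cantor_isometry_finite_iff)
qed

text \<open>The predicate \<open>even\<close> is itself a point of the Cantor space, and its images
  under \<open>odd_flip a\<close> are distinct for distinct \<open>a\<close>.\<close>

lemma uncountable_cantor_orbit_even: "uncountable (orbit cantor_group (\<lambda>g. g) even)"
proof
  assume "countable (orbit cantor_group (\<lambda>g. g) even)"
  moreover have "range (\<lambda>a. odd_flip a even) \<subseteq> orbit cantor_group (\<lambda>g. g) even"
    using odd_flip_in_isometries by (auto simp: orbit_def)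
  moreover have "inj (\<lambda>a. odd_flip a even)"
  proof (rule injI)
    fix a b assume eq: "odd_flip a even = odd_flip b even"
    show "a = b"
    proof
      \<comment> \<open>All even bits of \<open>even\<close> are set and all odd ones clear, so bit
        \<open>2 * i + 1\<close> of the image is exactly \<open>a i\<close>.\<close>
      fix i show "a i = b i"
        using fun_cong[OF eq, of "2 * i + 1"] by (simp add: odd_flip_def)
    qed
  qed
  ultimately show False
    using uncountable_cantor by (metis countable_image_inj_on countable_subset)
qed

lemma orbits_of_common_closure_not_homeomorphic:
  "\<exists>(G :: ((nat \<Rightarrow> bool) \<Rightarrow> (nat \<Rightarrow> bool)) monoid) T (X :: (nat \<Rightarrow> bool) topology) \<phi> \<D>.
     G_space G T X \<phi> \<and> property_b G T X \<phi> \<and> orbit_closure_decomposition G T X \<phi> \<D> \<and>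
     (\<exists>U\<in>\<D>. \<exists>x\<in>U. \<exists>y\<in>U.
        \<not> subtopology X (orbit G \<phi> x) homeomorphic_space subtopology X (orbit G \<phi> y))"
proof -
  let ?orb = "orbit cantor_group (\<lambda>g. g)" and ?zero = "\<lambda>_. False :: bool"
  obtain \<D> where \<D>: "orbit_closure_decomposition cantor_group cantor_group_topology euclidean (\<lambda>g. g) \<D>"
    using G_space.property_a_imp_decomposition[OF G_space_cantor]
      G_space.property_b_imp_property_a[OF G_space_cantor property_b_cantor] by blast
  then have "?zero \<in> \<Union>\<D>"
    by (simp add: orbit_closure_decomposition_def partition_on_def)
  then obtain U where U: "U \<in> \<D>" "?zero \<in> U"
    by (rule UnionE)
  \<comment> \<open>The orbit of zero is dense, so \<open>U\<close> is the whole space and contains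
    \<open>even\<close>.\<close>
  have "U = closure (?orb ?zero)"
    using G_space.property_b_imp_eq_orbit_closure[OF G_space_cantor property_b_cantor \<D> U] by simp
  moreover have "x \<in> closure (?orb ?zero)" for x
    unfolding closure_iff_nhds_not_empty
  proof (intro allI impI)
    fix A Q assume Q: "Q \<subseteq> A" "open Q" "x \<in> Q"
    then obtain e where "e \<in> Q" "finite {i. e i}"
      using open_meets_finite_support by blast
    then have "e \<in> ?orb ?zero \<inter> A"
      using Q(1) by (auto simp: cantor_orbit_zero)
    then show "?orb ?zero \<inter> A \<noteq> {}"
      by blast
  qed
  ultimately have "even \<in> U"
    by simp
  \<comment> \<open>A homeomorphism would map a countable set onto an uncountable one.\<close>
  have "\<not> top_of_set (?orb ?zero) homeomorphic_space top_of_set (?orb even)"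
  proof
    assume "top_of_set (?orb ?zero) homeomorphic_space top_of_set (?orb even)"
    then obtain f where "homeomorphic_map (top_of_set (?orb ?zero)) (top_of_set (?orb even)) f"
      by (auto simp: homeomorphic_space)
    then have "f ` ?orb ?zero = ?orb even"
      using homeomorphic_imp_surjective_map by fastforce
    then have "countable (?orb even)"
      using countable_image[OF countable_finite_support, of f] by (simp add: cantor_orbit_zero)
    then show False
      using uncountable_cantor_orbit_even by simp
  qed
  then have "\<exists>U\<in>\<D>. \<exists>x\<in>U. \<exists>y\<in>U. \<not> top_of_set (?orb x) homeomorphic_space top_of_set (?orb y)"
    using U \<open>even \<in> U\<close> by (intro bexI)
  with G_space_cantor property_b_cantor \<D> show ?thesis
    by (intro exI conjI)
qed

theorem theorem4:
  fixes G :: "('g, 'm) monoid_scheme" and T :: "'g topology"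
    and X :: "'x topology" and \<phi> :: "'g \<Rightarrow> 'x \<Rightarrow> 'x"
  shows
    "(G_space G T X \<phi> \<and> property_a G T X \<phi> \<longrightarrow>
        (\<exists>\<D>. orbit_closure_decomposition G T X \<phi> \<D>)) \<and>
     (G_space G T X \<phi> \<and> property_b G T X \<phi> \<longrightarrow>
        (\<exists>\<D>. orbit_closure_decomposition G T X \<phi> \<D>) \<and>
        (\<forall>\<D>. orbit_closure_decomposition G T X \<phi> \<D> \<longrightarrow>
           (\<forall>U\<in>\<D>. \<forall>x\<in>U. U = X closure_of (orbit G \<phi> x)))) \<and>
     (\<exists>(G' :: ((nat \<Rightarrow> bool) \<Rightarrow> (nat \<Rightarrow> bool)) monoid) T'
        (X' :: (nat \<Rightarrow> bool) topology) \<phi>' \<D>.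
        G_space G' T' X' \<phi>' \<and> property_b G' T' X' \<phi>' \<and>
        orbit_closure_decomposition G' T' X' \<phi>' \<D> \<and>
        (\<exists>U\<in>\<D>. \<exists>x\<in>U. \<exists>y\<in>U.
           \<not> subtopology X' (orbit G' \<phi>' x) homeomorphic_space
             subtopology X' (orbit G' \<phi>' y))) \<and>
     (G_space G T X \<phi> \<and> property_c G T X \<phi> \<longrightarrow>
        (\<exists>\<D>. orbit_closure_decomposition G T X \<phi> \<D>) \<and>
        (\<forall>\<D>. orbit_closure_decomposition G T X \<phi> \<D> \<longrightarrow>
           (\<forall>U\<in>\<D>. \<forall>x\<in>U.
              subtopology X U homeomorphic_space subtopology X (orbit G \<phi> x))))"
proof (intro conjI impI allI ballI; (elim conjE)?)
  assume "G_space G T X \<phi>" and "property_a G T X \<phi>"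
  then show "\<exists>\<D>. orbit_closure_decomposition G T X \<phi> \<D>"
    by (rule G_space.property_a_imp_decomposition)
next
  assume "G_space G T X \<phi>" and "property_b G T X \<phi>"
  then show "\<exists>\<D>. orbit_closure_decomposition G T X \<phi> \<D>"
    by (intro G_space.property_a_imp_decomposition G_space.property_b_imp_property_a)
next
  fix \<D> U x
  assume "G_space G T X \<phi>" and "property_b G T X \<phi>"
    and "orbit_closure_decomposition G T X \<phi> \<D>" "U \<in> \<D>" "x \<in> U"
  then show "U = X closure_of orbit G \<phi> x"
    by (rule G_space.property_b_imp_eq_orbit_closure)
next
  assume "G_space G T X \<phi>" and "property_c G T X \<phi>"
  then show "\<exists>\<D>. orbit_closure_decomposition G T X \<phi> \<D>"
    by (intro G_space.property_a_imp_decomposition G_space.property_b_imp_property_a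
        G_space.property_c_imp_property_b)
next
  fix \<D> U x
  assume "G_space G T X \<phi>" and "property_c G T X \<phi>"
    and "orbit_closure_decomposition G T X \<phi> \<D>" "U \<in> \<D>" "x \<in> U"
  \<comment> \<open>The two subspaces are equal, so the identity is the homeomorphism.\<close>
  then have "U = orbit G \<phi> x"
    by (rule G_space.property_c_imp_eq_orbit)
  then show "subtopology X U homeomorphic_space subtopology X (orbit G \<phi> x)"
    by (simp add: homeomorphic_space_refl)
qed (rule orbits_of_common_closure_not_homeomorphic)

end
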